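(* Let $\mathbf\Phi(\mathbf N,\mathbf f_k,\Delta t)$ be an order-$p$ increment function. The step-truncation method $$\mathbf a_k=\mathbf f_k+\Delta t\,\mathbf\Phi(\mathbf N,\mathbf f_k,\Delta t),\qquad \mathbf f_{k+1}=\mathfrak T^{\rm SVD}_{\mathbf r_k}(\mathbf a_k),$$ approximates $\frac{d\mathbf f}{dt}=\mathbf N(\mathbf f)$ with order-$p$ local truncation error if and only if there exists an $M>0$ (independent of $k$ and $\Delta t$) such that the rank $\mathbf r_k$ at time index $k$ satisfies $$\left\|\mathbf a_k-\mathfrak T^{\rm best}_{\mathbf r_k}(\mathbf a_k)\right\|_2\le M\Delta t^{p+1}.$$
   Context: Throughout, $d\ge2$, $\|\cdot\|_2$ is the Euclidean (Frobenius) norm on $\mathbb R^{n_1\times\cdots\times n_d}$, $\mathbf N$ is a map from this space to itself, $\Delta t>0$ is a (sufficiently small) time step and $t_k=k\Delta t$. Increment function of order $p$: $\mathbf\Phi(\mathbf N,\cdot,\Delta t)$ maps tensors to tensors, and there is a constant $K$, independent of $k$ and $\Delta t$, such that $\|\mathbf f(t_{k+1})-(\mathbf f_k+\Delta t\,\mathbf\Phi(\mathbf N,\mathbf f_k,\Delta t))\|_2\le K\Delta t^{p+1}$ for all sufficiently small $\Delta t$, where $\mathbf f(t)$ is the exact solution of $\frac{d\mathbf f}{dt}=\mathbf N(\mathbf f)$ with $\mathbf f(t_k)=\mathbf f_k$. Order-$p$ local truncation error of the step-truncation method: there is a constant $C_1$, independent of $k$ and $\Delta t$, with $\|\mathbf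 f(t_{k+1})-\mathbf f_{k+1}\|_2\le C_1\Delta t^{p+1}$, where again $\mathbf f(t)$ is the exact solution with $\mathbf f(t_k)=\mathbf f_k$. Hierarchical Tucker format: fix a dimension tree $\mathcal T_d$ (binary tree with root $\{1,\dots,d\}$, leaves the singletons, every non-leaf node the disjoint union of its two children). For $\alpha\in\mathcal T_d$, $\mathbf f^{(\alpha)}$ is the matricization of $\mathbf f$ with rows indexed by the modes in $\alpha$ and columns by the others. For $\mathbf r=\{r_\alpha\}$, $\mathcal H_{\mathbf r}=\{\mathbf f:\operatorname{rank}\mathbf f^{(\alpha)}=r_\alpha\ \forall\alpha\}$, with closure $\overline{\mathcal H}_{\mathbf r}=\{\mathbf f:\operatorname{rank}\mathbf f^{(\alpha)}\le r_\alpha\ \forall\alpha\}$. Best truncation: $\mathfrak T^{\rm best}_{\mathbf r}(\mathbf f)\in\operatorname{argmin}_{\mathbf h\in\overline{\mathcal H}_{\mathbf r}}\|\mathbf f-\mathbf h\|_2$ (a fixed choice of minimizer). SVD truncation (HOSVD): $\mathfrak T^{\rm SVD}_{\mathbf r}(\mathbf f)=\prod_{\alpha\in\mathcal T_d^{\ell}}\mathbf P_\alpha\cdots\prod_{\alpha\in\mathcal T_d^{1}}\mathbf P_\alpha\,\mathbf f$, where $\mathcal T_d^1,\dots,\mathcal T_d^\ell$ are the layers of $\mathcal T_d$ (below the root, from top to bottom) and $\mathbf P_\alpha$ is the orthogonal projection acting on the $\alpha$-modes onto the span of $r_\alpha$ leading left singular vectors of $\mathbf f^{(\alpha)}$. It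 is known that $\|\mathbf f-\mathfrak T^{\rm best}_{\mathbf r}(\mathbf f)\|_2\le\|\mathbf f-\mathfrak T^{\rm SVD}_{\mathbf r}(\mathbf f)\|_2\le\sqrt{2d-3}\,\|\mathbf f-\mathfrak T^{\rm best}_{\mathbf r}(\mathbf f)\|_2$. The rank $\mathbf r_k$ may change from step to step. *)

theory Defs
  imports "HOL-Analysis.Analysis" "Jordan_Normal_Form.DL_Rank"
begin

no_notation Matrix.vec_index (infixl \<open>$\<close> 100)

section \<open>Tensors and matricizations\<close>

text \<open>
  A tensor of size \<open>n 1 \<times> \<dots> \<times> n d\<close> is a vector of \<open>real ^ 'i\<close>, where \<open>idx\<close> identifies the finite
  index type \<open>'i\<close> with the set of multi-indices (counted from 0 in each mode). Thus
  \<open>norm\<close> on \<open>real ^ 'i\<close> is the Euclidean (Frobenius) norm of tensors.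
\<close>

definition tensor_index :: "nat \<Rightarrow> (nat \<Rightarrow> nat) \<Rightarrow> ('i::finite \<Rightarrow> nat \<Rightarrow> nat) \<Rightarrow> bool" where
  "tensor_index d n idx \<longleftrightarrow> bij_betw idx UNIV (\<Pi>\<^sub>E m\<in>{1..d}. {..<n m})"

text \<open>
  Position of the multi-index \<open>i\<close>, restricted to the modes in \<open>\<alpha>\<close>, in colexicographic order
  (the smallest mode varies fastest).
\<close>

definition linear_index :: "(nat \<Rightarrow> nat) \<Rightarrow> nat set \<Rightarrow> (nat \<Rightarrow> nat) \<Rightarrow> nat" where
  "linear_index n \<alpha> i = (\<Sum>m\<in>\<alpha>. i m * (\<Prod>l\<in>{l\<in>\<alpha>. l < m}. n l))"

definition matricize ::
  "nat \<Rightarrow> (nat \<Rightarrow> nat) \<Rightarrow> ('i::finite \<Rightarrow> nat \<Rightarrow> nat) \<Rightarrow> nat set \<Rightarrow> real ^ 'i \<Rightarrow> real mat" where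
  "matricize d n idx \<alpha> f =
     Matrix.mat (\<Prod>m\<in>\<alpha>. n m) (\<Prod>m\<in>{1..d} - \<alpha>. n m)
       (\<lambda>(a, b). f $ (THE i. linear_index n \<alpha> (idx i) = a \<and> linear_index n ({1..d} - \<alpha>) (idx i) = b))"

text \<open>\<open>tensorize\<close> inverts \<open>matricize\<close>, for \<open>\<alpha> \<subseteq> {1..d}\<close>.\<close>

definition tensorize ::
  "nat \<Rightarrow> (nat \<Rightarrow> nat) \<Rightarrow> ('i::finite \<Rightarrow> nat \<Rightarrow> nat) \<Rightarrow> nat set \<Rightarrow> real mat \<Rightarrow> real ^ 'i" where
  "tensorize d n idx \<alpha> A =
     (\<chi> i. A $$ (linear_index n \<alpha> (idx i), linear_index n ({1..d} - \<alpha>) (idx i)))"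

definition mode_mult ::
  "nat \<Rightarrow> (nat \<Rightarrow> nat) \<Rightarrow> ('i::finite \<Rightarrow> nat \<Rightarrow> nat) \<Rightarrow> nat set \<Rightarrow> real mat \<Rightarrow> real ^ 'i \<Rightarrow> real ^ 'i" where
  "mode_mult d n idx \<alpha> P f = tensorize d n idx \<alpha> (P * matricize d n idx \<alpha> f)"


section \<open>Dimension trees\<close>

text \<open>A tree is identified by its leaves, a node by the set of modes below it.\<close>

datatype dim_tree = Leaf nat | Branch dim_tree dim_tree

primrec modes :: "dim_tree \<Rightarrow> nat set" where
  "modes (Leaf m) = {m}"
| "modes (Branch s t) = modes s \<union> modes t"

primrec nodes :: "dim_tree \<Rightarrow> nat set set" where
  "nodes (Leaf m) = {{m}}"
| "nodes (Branch s t) = insert (modes (Branch s t)) (nodes s \<union> nodes t)"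

primrec disjoint_children :: "dim_tree \<Rightarrow> bool" where
  "disjoint_children (Leaf m) \<longleftrightarrow> True"
| "disjoint_children (Branch s t) \<longleftrightarrow>
     modes s \<inter> modes t = {} \<and> disjoint_children s \<and> disjoint_children t"

definition dimension_tree :: "nat \<Rightarrow> dim_tree \<Rightarrow> bool" where
  "dimension_tree d T \<longleftrightarrow> modes T = {1..d} \<and> disjoint_children T"

primrec depth :: "dim_tree \<Rightarrow> nat" where
  "depth (Leaf m) = 0"
| "depth (Branch s t) = Suc (max (depth s) (depth t))"

text \<open>\<open>layer T j\<close> lists the nodes at distance \<open>j\<close> from the root.\<close>

primrec layer :: "dim_tree \<Rightarrow> nat \<Rightarrow> nat set list" where
  "layer (Leaf m) j = (if j = 0 then [{m}] else [])"
| "layer (Branch s t) j =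
     (case j of 0 \<Rightarrow> [modes (Branch s t)] | Suc j' \<Rightarrow> layer s j' @ layer t j')"

definition nodes_below_root :: "dim_tree \<Rightarrow> nat set list" where
  "nodes_below_root T = concat (map (layer T) [1..<Suc (depth T)])"


section \<open>Truncation in the hierarchical Tucker format\<close>

definition ht_closure ::
  "nat \<Rightarrow> (nat \<Rightarrow> nat) \<Rightarrow> ('i::finite \<Rightarrow> nat \<Rightarrow> nat) \<Rightarrow> dim_tree \<Rightarrow> (nat set \<Rightarrow> nat) \<Rightarrow> (real ^ 'i) set" where
  "ht_closure d n idx T r =
     {f. \<forall>\<alpha>\<in>nodes T. vec_space.rank (\<Prod>m\<in>\<alpha>. n m) (matricize d n idx \<alpha> f) \<le> r \<alpha>}"

definition is_best_truncation ::
  "nat \<Rightarrow> (nat \<Rightarrow> nat) \<Rightarrow> ('i::finite \<Rightarrow> nat \<Rightarrow> nat) \<Rightarrow> dim_tree \<Rightarrow> (nat set \<Rightarrow> nat) \<Rightarrow>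
     real ^ 'i \<Rightarrow> real ^ 'i \<Rightarrow> bool" where
  "is_best_truncation d n idx T r f g \<longleftrightarrow>
     is_arg_min (\<lambda>h. norm (f - h)) (\<lambda>h. h \<in> ht_closure d n idx T r) g"

definition is_svd :: "real mat \<Rightarrow> real mat \<Rightarrow> real mat \<Rightarrow> real mat \<Rightarrow> bool" where
  "is_svd A U S V \<longleftrightarrow>
     (let m = dim_row A; k = dim_col A in
      U \<in> carrier_mat m m \<and> S \<in> carrier_mat m k \<and> V \<in> carrier_mat k k \<and>
      transpose_mat U * U = 1\<^sub>m m \<and> transpose_mat V * V = 1\<^sub>m k \<and>
      diagonal_mat S \<and>
      (\<forall>j < min m k. 0 \<le> S $$ (j, j)) \<and>
      (\<forall>j < min m k. \<forall>i \<le> j. S $$ (j, j) \<le> S $$ (i, i)) \<and>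
      A = U * S * transpose_mat V)"

text \<open>
  Since the columns of \<open>U\<close> are orthonormal, \<open>W * transpose_mat W\<close> is the orthogonal projection onto
  the span of the first \<open>r\<close> columns of \<open>U\<close> (onto the whole space, if there are fewer than \<open>r\<close>).
\<close>

definition leading_projection :: "nat \<Rightarrow> real mat \<Rightarrow> real mat \<Rightarrow> bool" where
  "leading_projection r A P \<longleftrightarrow>
     (\<exists>U S V. is_svd A U S V \<and>
        (let W = Matrix.mat (dim_row U) (min r (dim_col U)) (\<lambda>(i, j). U $$ (i, j))
         in P = W * transpose_mat W))"

text \<open>
  All projections come from the matricizations of \<open>f\<close> itself; \<open>fold\<close> applies them layer by layer,
  the layer next to the root first. Within a layer the nodes are disjoint, so the order is irrelevant.
\<close>

definition is_svd_truncation ::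
  "nat \<Rightarrow> (nat \<Rightarrow> nat) \<Rightarrow> ('i::finite \<Rightarrow> nat \<Rightarrow> nat) \<Rightarrow> dim_tree \<Rightarrow> (nat set \<Rightarrow> nat) \<Rightarrow>
     real ^ 'i \<Rightarrow> real ^ 'i \<Rightarrow> bool" where
  "is_svd_truncation d n idx T r f g \<longleftrightarrow>
     (\<exists>P. (\<forall>\<alpha>\<in>set (nodes_below_root T). leading_projection (r \<alpha>) (matricize d n idx \<alpha> f) (P \<alpha>)) \<and>
          g = fold (\<lambda>\<alpha>. mode_mult d n idx \<alpha> (P \<alpha>)) (nodes_below_root T) f)"


section \<open>Local errors of one-step methods\<close>

definition solves_ivp ::
  "('a::real_normed_vector \<Rightarrow> 'a) \<Rightarrow> real \<Rightarrow> 'a \<Rightarrow> real \<Rightarrow> (real \<Rightarrow> 'a) \<Rightarrow> bool" where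
  "solves_ivp N s x t u \<longleftrightarrow>
     u s = x \<and> (\<forall>\<tau>\<in>{s..t}. (u has_vector_derivative N (u \<tau>)) (at \<tau> within {s..t}))"

text \<open>
  Below, \<open>h\<close> is the time step, \<open>t\<^sub>k = k h\<close>, and \<open>f h k\<close> is the \<open>k\<close>-th iterate computed with
  time step \<open>h\<close>. The constants do not depend on \<open>k\<close> and \<open>h\<close>.
\<close>

definition increment_function_of_order ::
  "nat \<Rightarrow> (('a::real_normed_vector \<Rightarrow> 'a) \<Rightarrow> 'a \<Rightarrow> real \<Rightarrow> 'a) \<Rightarrow> ('a \<Rightarrow> 'a) \<Rightarrow> (real \<Rightarrow> nat \<Rightarrow> 'a) \<Rightarrow> bool" where
  "increment_function_of_order p \<Phi> N f \<longleftrightarrow>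
     (\<exists>K. \<forall>\<^sub>F h in at_right 0. \<forall>k u.
        solves_ivp N (real k * h) (f h k) (real (Suc k) * h) u \<longrightarrow>
        norm (u (real (Suc k) * h) - (f h k + h *\<^sub>R \<Phi> N (f h k) h)) \<le> K * h ^ (p + 1))"

definition local_truncation_error_of_order ::
  "nat \<Rightarrow> ('a::real_normed_vector \<Rightarrow> 'a) \<Rightarrow> (real \<Rightarrow> nat \<Rightarrow> 'a) \<Rightarrow> bool" where
  "local_truncation_error_of_order p N f \<longleftrightarrow>
     (\<exists>C. \<forall>\<^sub>F h in at_right 0. \<forall>k u.
        solves_ivp N (real k * h) (f h k) (real (Suc k) * h) u \<longrightarrow>
        norm (u (real (Suc k) * h) - f h (Suc k)) \<le> C * h ^ (p + 1))"

end

theory Submission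
  imports Defs
begin

text \<open>
  Write \<open>h\<close> for the time step, \<open>a\<close> for the untruncated step, \<open>u\<close> for the exact solution at the end of
  the step and \<open>g\<close> for the SVD truncation of \<open>a\<close>. The triangle inequality compares \<open>norm (u - g)\<close>
  with \<open>norm (a - g)\<close> up to \<open>norm (u - a)\<close>, which the order of the increment function bounds by a multiple
  of \<open>h ^ (p + 1)\<close>. Hence the local error has order \<open>p\<close> exactly if \<open>norm (a - g)\<close> is bounded by a multiple
  of \<open>h ^ (p + 1)\<close>, and it remains to see that \<open>norm (a - g)\<close> and the best approximation error bound each
  other up to a factor that depends on the tree and the tensor size alone.

  The best error is at most \<open>norm (a - g)\<close> because \<open>g\<close> satisfies all rank bounds
  (\<open>svd_truncation_in_ht_closure\<close>). Projecting the modes of a node \<open>\<alpha>\<close> enforces the bound at \<open>\<alpha>\<close>. Every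
  projection applied later acts on modes that are either all in \<open>\<alpha>\<close> or all outside \<open>\<alpha>\<close>, since the tree is
  traversed from the root downwards; such a projection multiplies the matricization at \<open>\<alpha>\<close> from one side
  and cannot raise its rank (\<open>separable_mode_mult\<close>). At the root the matricization is a single column, so
  its rank is at most 1.

  In the other direction, \<open>norm (a - g)\<close> is at most a constant times the best error
  (\<open>norm_minus_svd_truncation_le\<close>). The projections are contractions, so their errors on \<open>a\<close> add up
  (\<open>norm_minus_fold_nonexpansive_le\<close>). The error of one projection is the norm of the discarded singular values
  of a matricization. Each of these is at most the distance of that matricization to any matrix that
  satisfies the rank bound (\<open>singular_value_le_frob_dist\<close>), in particular to the matricization of the best
  approximation.
\<close>

section \<open>Rank of products and nontrivial kernels\<close>

lemma (in vec_space) rank_mult_le_left: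
  assumes "A \<in> carrier_mat n s" "B \<in> carrier_mat s t"
  shows "rank (A * B) \<le> rank A"
proof -
  have AB: "A * B \<in> carrier_mat n t" using assms by simp
  have cols: "set (cols A) \<subseteq> carrier_vec n" "set (cols (A * B)) \<subseteq> carrier_vec n"
    using assms(1) AB by (metis carrier_matD(1) cols_dim)+
  have "set (cols (A * B)) \<subseteq> span (set (cols A))"
  proof
    fix v assume "v \<in> set (cols (A * B))"
    then obtain j where j: "j < t" "v = col (A * B) j"
      using AB by (metis carrier_matD(2) cols_length cols_nth in_set_conv_nth)
    then have "v = A *\<^sub>v col B j" using assms by (metis col_mult2)
    moreover have "A *\<^sub>v col B j \<in> carrier_vec n" "col B j \<in> carrier_vec s"
      using assms j(1) by auto
    ultimately have "v \<in> col_space A"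
      using assms(1) unfolding col_space_eq[OF assms(1)] by auto
    then show "v \<in> span (set (cols A))" by (simp add: col_space_def)
  qed
  then have "span (set (cols (A * B))) \<subseteq> span (set (cols A))"
    using cols(1) span_is_subset span_is_submodule by metis
  then have sub: "subspace class_ring (span (set (cols (A * B)))) (vs (span (set (cols A))))"
    using cols span_is_subspace nested_subspaces by metis
  show ?thesis
    using vectorspace.subspace_dim[OF subspace_is_vs[OF span_is_subspace[OF cols(1)]] sub]
    unfolding rank_def using fin_dim_span_cols[OF assms(1)] fin_dim_span_cols[OF AB] by simp
qed

lemma rank_mult_le_inner:
  assumes "A \<in> carrier_mat m s" "B \<in> carrier_mat s t"
  shows "vec_space.rank m (A * B :: 'a::field mat) \<le> s"
  using vec_space.rank_mult_le_left[OF assms] vec_space.rank_le_nc[OF assms(1)] by linarith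

text \<open>
  The kernel vector is a plain family of coefficients, so that it can serve as a column matrix later.
  A column that occurs twice gives a kernel vector at once; distinct columns are dependent because the
  rank is too small.
\<close>

lemma (in vec_space) rank_less_imp_kernel:
  assumes A: "A \<in> carrier_mat n t" and "rank A < t"
  obtains x where "\<exists>c<t. x c \<noteq> 0" "\<And>i. i < n \<Longrightarrow> (\<Sum>c<t. A $$ (i, c) * x c) = 0"
proof (cases "distinct (cols A)")
  case True
  with assms lin_indpt_full_rank have "lin_dep (set (cols A))" by (metis less_irrefl)
  then obtain v where v: "v \<in> carrier_vec t" "v \<noteq> 0\<^sub>v t" "A *\<^sub>v v = 0\<^sub>v n"
    using lin_depE[OF A _ True] by blast
  show thesis
  proof (rule that)
    show "\<exists>c<t. vec_index v c \<noteq> 0" using v(1,2) by (auto simp: vec_eq_iff)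
    fix i assume "i < n"
    then have "vec_index (A *\<^sub>v v) i = 0" using v(3) by simp
    then show "(\<Sum>c<t. A $$ (i, c) * vec_index v c) = 0"
      using A v(1) \<open>i < n\<close> by (simp add: scalar_prod_def atLeast0LessThan)
  qed
next
  case False
  then obtain i j where ij: "i < t" "j < t" "i \<noteq> j" "col A i = col A j"
    using A by (auto simp: distinct_conv_nth)
  let ?x = "\<lambda>c. (if c = i then 1 else 0) - (if c = j then 1 else (0::'a))"
  have "(\<Sum>c<t. A $$ (a, c) * ?x c) = 0" if "a < n" for a
  proof -
    have "A $$ (a, i) = A $$ (a, j)" using that ij A by (metis carrier_matD index_col)
    then show ?thesis
      using ij by (simp add: right_diff_distrib sum_subtractf if_distrib[of "(*) _"] cong: if_cong)
  qed
  moreover have "?x i \<noteq> 0" using ij by simp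
  ultimately show thesis using that[of ?x] ij by blast
qed

lemma mult_index_sum:
  assumes "A \<in> carrier_mat m k" "B \<in> carrier_mat k l" "i < m" "j < l"
  shows "(A * B) $$ (i, j) = (\<Sum>c<k. A $$ (i, c) * B $$ (c, j))"
  using assms by (simp add: scalar_prod_def atLeast0LessThan)

section \<open>The Frobenius norm and truncated singular value decompositions\<close>

definition frob_sq :: "real mat \<Rightarrow> real" where
  "frob_sq A = (\<Sum>i<dim_row A. \<Sum>j<dim_col A. (A $$ (i, j))\<^sup>2)"

lemma frob_sq_carrier: "A \<in> carrier_mat m k \<Longrightarrow> frob_sq A = (\<Sum>i<m. \<Sum>j<k. (A $$ (i, j))\<^sup>2)"
  by (auto simp: frob_sq_def)

lemma frob_sq_transpose: "frob_sq (transpose_mat A) = frob_sq A"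
  unfolding frob_sq_def by (subst sum.swap) simp

lemma frob_sq_eq_gram_trace:
  assumes "A \<in> carrier_mat m k"
  shows "frob_sq A = (\<Sum>j<k. (transpose_mat A * A) $$ (j, j))"
  unfolding frob_sq_carrier[OF assms]
  by (subst sum.swap) (use assms in \<open>auto simp: scalar_prod_def power2_eq_square intro!: sum.cong simp flip: atLeast0LessThan\<close>)

text \<open>
  The norm is the trace of the Gram matrix, in which \<open>transpose_mat U * U\<close> cancels.
\<close>

lemma frob_sq_mult_orth_left:
  assumes "U \<in> carrier_mat m m" "transpose_mat U * U = 1\<^sub>m m" "A \<in> carrier_mat m k"
  shows "frob_sq (U * A) = frob_sq A"
proof -
  have "transpose_mat (U * A) * (U * A) = transpose_mat A * (transpose_mat U * (U * A))"
    using assms by (simp add: transpose_mult[of U m m A k] assoc_mult_mat[of _ k m _ m _ k])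
  also have "transpose_mat U * (U * A) = (transpose_mat U * U) * A"
    using assms by (intro assoc_mult_mat[symmetric]) auto
  also have "\<dots> = A" using assms by simp
  finally show ?thesis using assms by (simp add: frob_sq_eq_gram_trace[of _ m k])
qed

lemma orth_mult_transpose:
  assumes "V \<in> carrier_mat k k" "transpose_mat V * V = (1\<^sub>m k :: real mat)"
  shows "V * transpose_mat V = 1\<^sub>m k"
  using assms by (metis mat_mult_left_right_inverse transpose_carrier_mat)

lemma frob_sq_mult_orth_right:
  assumes "V \<in> carrier_mat k k" "transpose_mat V * V = 1\<^sub>m k" "A \<in> carrier_mat m k"
  shows "frob_sq (A * V) = frob_sq A"
proof -
  have "frob_sq (A * V) = frob_sq (transpose_mat V * transpose_mat A)"
    using assms by (simp add: frob_sq_transpose flip: transpose_mult[of A m k V k])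
  also have "\<dots> = frob_sq (transpose_mat A)"
    using assms orth_mult_transpose[OF assms(1,2)] by (intro frob_sq_mult_orth_left[of _ k _ m]) auto
  finally show ?thesis by (simp add: frob_sq_transpose)
qed

lemma frob_sq_nonneg: "0 \<le> frob_sq A"
  by (simp add: frob_sq_def sum_nonneg)

lemma frob_sq_mult_le:
  assumes "A \<in> carrier_mat m k" "B \<in> carrier_mat k l"
  shows "frob_sq (A * B) \<le> frob_sq A * frob_sq B"
proof -
  have "frob_sq (A * B) = (\<Sum>i<m. \<Sum>j<l. (\<Sum>c<k. A $$ (i, c) * B $$ (c, j))\<^sup>2)"
    using assms by (subst frob_sq_carrier[of _ m l]) (auto simp: mult_index_sum[OF assms] simp del: index_mult_mat(1) intro!: sum.cong)
  also have "\<dots> \<le> (\<Sum>i<m. \<Sum>j<l. (\<Sum>c<k. (A $$ (i, c))\<^sup>2) * (\<Sum>c<k. (B $$ (c, j))\<^sup>2))"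
    by (intro sum_mono Cauchy_Schwarz_ineq_sum)
  also have "\<dots> = frob_sq A * (\<Sum>j<l. \<Sum>c<k. (B $$ (c, j))\<^sup>2)"
    unfolding frob_sq_carrier[OF assms(1)] by (rule sum_product[symmetric])
  also have "(\<Sum>j<l. \<Sum>c<k. (B $$ (c, j))\<^sup>2) = frob_sq B"
    unfolding frob_sq_carrier[OF assms(2)] by (rule sum.swap)
  finally show ?thesis .
qed

definition cutoff_mat :: "nat \<Rightarrow> nat \<Rightarrow> real mat" where
  "cutoff_mat m r = Matrix.mat m m (\<lambda>(i, j). if i = j \<and> i < r then 1 else 0)"

lemma cutoff_mat_carrier [simp]: "cutoff_mat m r \<in> carrier_mat m m"
  by (simp add: cutoff_mat_def)

lemma cutoff_mat_mult_index:
  assumes "A \<in> carrier_mat m k" "i < m" "j < k"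
  shows "(cutoff_mat m r * A) $$ (i, j) = (if i < r then A $$ (i, j) else 0)"
proof -
  have "(cutoff_mat m r * A) $$ (i, j) = (\<Sum>c<m. if i = c then (if i < r then A $$ (c, j) else 0) else 0)"
    unfolding mult_index_sum[OF cutoff_mat_carrier assms]
    using assms by (intro sum.cong) (auto simp: cutoff_mat_def)
  then show ?thesis using assms by simp
qed

lemma is_svdD:
  assumes "is_svd A U S V" "A \<in> carrier_mat m k"
  shows "U \<in> carrier_mat m m" "S \<in> carrier_mat m k" "V \<in> carrier_mat k k"
    "transpose_mat U * U = 1\<^sub>m m" "transpose_mat V * V = 1\<^sub>m k"
    "A = U * S * transpose_mat V"
    "\<And>i j. i < m \<Longrightarrow> j < k \<Longrightarrow> i \<noteq> j \<Longrightarrow> S $$ (i, j) = 0"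
    "\<And>j. j < min m k \<Longrightarrow> 0 \<le> S $$ (j, j)"
    "\<And>i j. i \<le> j \<Longrightarrow> j < min m k \<Longrightarrow> S $$ (j, j) \<le> S $$ (i, i)"
  using assms by (auto simp: is_svd_def Let_def diagonal_mat_def)

text \<open>
  Conjugation with the square orthogonal \<open>U\<close> turns the projection into a cutoff of rows. Norms are
  invariant under \<open>U\<close>, so all estimates for the projection reduce to dropping rows.
\<close>

lemma leading_projectionE:
  assumes "leading_projection r A P" "A \<in> carrier_mat m k"
  obtains U S V where "is_svd A U S V" "P = U * cutoff_mat m r * transpose_mat U"
proof -
  obtain U S V where svd: "is_svd A U S V" and
    P: "P = Matrix.mat m (min r m) (\<lambda>(i, j). U $$ (i, j)) *
          transpose_mat (Matrix.mat m (min r m) (\<lambda>(i, j). U $$ (i, j)))" (is "_ = ?W * _")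
    using assms unfolding leading_projection_def Let_def by (metis carrier_matD is_svdD(1))
  have U: "U \<in> carrier_mat m m" using is_svdD(1)[OF svd assms(2)] .
  have UD: "(U * cutoff_mat m r) $$ (i, c) = (if c < r then U $$ (i, c) else 0)" if "i < m" "c < m" for i c
  proof -
    have "(U * cutoff_mat m r) $$ (i, c) = (\<Sum>l<m. if c = l then (if c < r then U $$ (i, l) else 0) else 0)"
      unfolding mult_index_sum[OF U cutoff_mat_carrier that]
      using that by (intro sum.cong) (auto simp: cutoff_mat_def)
    then show ?thesis using that by simp
  qed
  have "P $$ (i, j) = (U * cutoff_mat m r * transpose_mat U) $$ (i, j)" if "i < m" "j < m" for i j
  proof -
    have "P $$ (i, j) = (\<Sum>c<min r m. U $$ (i, c) * U $$ (j, c))"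
      using that unfolding P by (subst mult_index_sum[of _ m "min r m" _ m]) auto
    also have "\<dots> = (\<Sum>c<m. (if c < r then U $$ (i, c) else 0) * U $$ (j, c))"
      by (intro sum.mono_neutral_cong_left) auto
    also have "\<dots> = (U * cutoff_mat m r * transpose_mat U) $$ (i, j)"
      using that U by (subst mult_index_sum[of _ m m _ m]) (auto simp: UD simp del: index_mult_mat(1))
    finally show ?thesis .
  qed
  then have "P = U * cutoff_mat m r * transpose_mat U"
    using U by (intro eq_matI) (auto simp: P simp del: index_mult_mat(1))
  with svd that show thesis by blast
qed

lemma leading_projection_carrier:
  assumes "leading_projection r A P" "A \<in> carrier_mat m k"
  shows "P \<in> carrier_mat m m"
  using assms by (auto simp: leading_projection_def Let_def dest!: is_svdD(1)[OF _ assms(2)])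

lemma frob_sq_leading_projection_le:
  assumes "leading_projection r A P" "A \<in> carrier_mat m k" "B \<in> carrier_mat m l"
  shows "frob_sq (P * B) \<le> frob_sq B"
proof -
  obtain U S V where svd: "is_svd A U S V" and P: "P = U * cutoff_mat m r * transpose_mat U"
    using leading_projectionE[OF assms(1,2)] .
  note U = is_svdD[OF svd assms(2)]
  let ?B = "transpose_mat U * B"
  have c: "?B \<in> carrier_mat m l" using U(1) assms(3) by simp
  have "P * B = U * (cutoff_mat m r * ?B)"
    using U(1) assms(3) by (simp add: P assoc_mult_mat[of _ m m _ m _ l])
  then have "frob_sq (P * B) = frob_sq (cutoff_mat m r * ?B)"
    using frob_sq_mult_orth_left[OF U(1,4) mult_carrier_mat[OF cutoff_mat_carrier c]] by simp
  also have "\<dots> \<le> frob_sq ?B"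
    using c by (auto simp: frob_sq_carrier[OF mult_carrier_mat[OF cutoff_mat_carrier c]] frob_sq_carrier[OF c] cutoff_mat_mult_index[OF c] simp del: index_mult_mat(1) intro!: sum_mono)
  also have "\<dots> = frob_sq B"
    using U(1) assms(3) orth_mult_transpose[OF U(1,4)] by (intro frob_sq_mult_orth_left) auto
  finally show ?thesis .
qed

text \<open>
  The first \<open>r + 1\<close> right singular vectors span a space on which \<open>A\<close> stretches every vector by at least
  \<open>S $$ (r, r)\<close>. By dimension, \<open>B\<close> kills a nonzero vector in that space, and there \<open>A - B\<close> acts as \<open>A\<close>.
\<close>

lemma singular_value_le_frob_dist:
  assumes svd: "is_svd A U S V" and A: "A \<in> carrier_mat m k" and B: "B \<in> carrier_mat m k"
    and rank: "vec_space.rank m B \<le> r" and r: "r < min m k"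
  shows "(S $$ (r, r))\<^sup>2 \<le> frob_sq (A - B)"
proof -
  note U = is_svdD[OF svd A]
  \<comment> \<open>\<open>V * E\<close> consists of the first \<open>r + 1\<close> right singular vectors; the column \<open>W\<close> below holds the
    coordinates, with respect to all of them, of the vector that \<open>B\<close> kills.\<close>
  define E :: "real mat" where "E = Matrix.mat k (Suc r) (\<lambda>(i, j). if i = j then 1 else 0)"
  have E: "E \<in> carrier_mat k (Suc r)" by (simp add: E_def)
  have BVE: "B * (V * E) \<in> carrier_mat m (Suc r)" using B U(3) E by simp
  have "vec_space.rank m (B * (V * E)) < Suc r"
    using vec_space.rank_mult_le_left[OF B, of "V * E" "Suc r"] U(3) E rank by simp
  then obtain x where x: "\<exists>c<Suc r. x c \<noteq> 0"
    "\<And>i. i < m \<Longrightarrow> (\<Sum>c<Suc r. (B * (V * E)) $$ (i, c) * x c) = 0"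
    using vec_space.rank_less_imp_kernel[OF BVE] by blast
  define X :: "real mat" where "X = Matrix.mat (Suc r) 1 (\<lambda>(c, _). x c)"
  define W where "W = E * X"
  have X: "X \<in> carrier_mat (Suc r) 1" by (simp add: X_def)
  then have W: "W \<in> carrier_mat k 1" using E by (simp add: W_def)
  have W_index: "W $$ (i, 0) = (if i \<le> r then x i else 0)" if "i < k" for i
  proof -
    have "W $$ (i, 0) = (\<Sum>c<Suc r. if i = c then x c else 0)"
      unfolding W_def using that
      by (subst mult_index_sum[OF E X that], simp, intro sum.cong) (auto simp: E_def X_def)
    then show ?thesis by (simp del: sum.lessThan_Suc)
  qed
  have "(B * V) * W = (B * (V * E)) * X"
    using B U(3) E X unfolding W_def
    by (simp add: assoc_mult_mat[of B m k _ k _ 1] assoc_mult_mat[of B m k _ "Suc r" X 1] assoc_mult_mat[of V k k E "Suc r" X 1])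
  also have "\<dots> = 0\<^sub>m m 1"
  proof (rule eq_matI)
    fix i j assume "i < dim_row (0\<^sub>m m 1 :: real mat)" "j < dim_col (0\<^sub>m m 1 :: real mat)"
    then have ij: "i < m" "j = 0" by auto
    have "(B * (V * E) * X) $$ (i, 0) = (\<Sum>c<Suc r. (B * (V * E)) $$ (i, c) * x c)"
      using mult_index_sum[OF BVE X ij(1), of 0] by (auto simp: X_def simp del: sum.lessThan_Suc index_mult_mat(1) intro: sum.cong)
    then show "(B * (V * E) * X) $$ (i, j) = 0\<^sub>m m 1 $$ (i, j)" using x(2) ij by simp
  qed (use B X in auto)
  finally have "(B * V) * W = 0\<^sub>m m 1" .
  moreover have "A * V = U * S"
    using U(1-5) unfolding U(6) by (simp add: assoc_mult_mat[of U m m _ k V k] assoc_mult_mat[of S m k _ k V k])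
  ultimately have "((A - B) * V) * W = U * (S * W) - 0\<^sub>m m 1"
    using A B U(1-3) W by (simp add: minus_mult_distrib_mat[of _ m k _ _ k] minus_mult_distrib_mat[of _ m k _ _ 1] assoc_mult_mat[of U m m S k W 1])
  also have "\<dots> = U * (S * W)"
    using U(1) W by (intro eq_matI) (auto simp del: index_mult_mat(1))
  finally have CW: "((A - B) * V) * W = U * (S * W)" .
  have "(S $$ (r, r))\<^sup>2 * frob_sq W \<le> frob_sq (S * W)"
  proof -
    have SW: "(S * W) $$ (i, 0) = (if i < k then S $$ (i, i) * W $$ (i, 0) else 0)" if "i < m" for i
    proof -
      have "(S * W) $$ (i, 0) = (\<Sum>c<k. S $$ (i, c) * W $$ (c, 0))"
        by (rule mult_index_sum[OF U(2) W that]) simp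
      also have "\<dots> = (\<Sum>c<k. if i = c then S $$ (i, c) * W $$ (c, 0) else 0)"
        using that U(7) by (intro sum.cong) auto
      finally show ?thesis by simp
    qed
    have "(S $$ (r, r))\<^sup>2 * frob_sq W = (\<Sum>i<k. (S $$ (r, r))\<^sup>2 * (W $$ (i, 0))\<^sup>2)"
      unfolding frob_sq_carrier[OF W] by (simp add: sum_distrib_left)
    also have "\<dots> = (\<Sum>i<Suc r. (S $$ (r, r))\<^sup>2 * (W $$ (i, 0))\<^sup>2)"
      using r by (intro sum.mono_neutral_right) (auto simp: W_index)
    also have "\<dots> \<le> (\<Sum>i<Suc r. ((S * W) $$ (i, 0))\<^sup>2)"
    proof (intro sum_mono)
      fix i assume i: "i \<in> {..<Suc r}"
      then have "(S $$ (r, r))\<^sup>2 \<le> (S $$ (i, i))\<^sup>2"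
        using U(8)[of r] U(9)[of i r] r by (intro power_mono) auto
      then show "(S $$ (r, r))\<^sup>2 * (W $$ (i, 0))\<^sup>2 \<le> ((S * W) $$ (i, 0))\<^sup>2"
        using i r by (subst SW) (auto simp: power_mult_distrib intro: mult_right_mono)
    qed
    also have "\<dots> \<le> (\<Sum>i<m. ((S * W) $$ (i, 0))\<^sup>2)"
      using r by (intro sum_mono2) auto
    also have "\<dots> = frob_sq (S * W)"
      unfolding frob_sq_carrier[OF mult_carrier_mat[OF U(2) W]] by simp
    finally show ?thesis .
  qed
  also have "\<dots> = frob_sq (U * (S * W))"
    using frob_sq_mult_orth_left[OF U(1,4) mult_carrier_mat[OF U(2) W]] by simp
  also have "\<dots> = frob_sq (((A - B) * V) * W)" by (simp add: CW)
  also have "\<dots> \<le> frob_sq ((A - B) * V) * frob_sq W"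
    using B U(3) W by (intro frob_sq_mult_le[of _ m k]) auto
  also have "frob_sq ((A - B) * V) = frob_sq (A - B)"
    using B by (intro frob_sq_mult_orth_right[OF U(3,5)]) auto
  finally have le: "(S $$ (r, r))\<^sup>2 * frob_sq W \<le> frob_sq (A - B) * frob_sq W" .
  obtain i where i: "i \<le> r" "x i \<noteq> 0" using x(1) by (auto simp: less_Suc_eq_le)
  have "0 < (W $$ (i, 0))\<^sup>2" using i r by (simp add: W_index)
  also have "\<dots> \<le> (\<Sum>i<k. (W $$ (i, 0))\<^sup>2)"
    using i r by (intro member_le_sum) auto
  also have "\<dots> = frob_sq W" unfolding frob_sq_carrier[OF W] by simp
  finally show ?thesis using le by simp
qed

text \<open>
  At most one singular value is discarded per row, and none of them exceeds the first discarded one,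
  \<open>S $$ (r, r)\<close>; this is where the factor \<open>m\<close> comes from.
\<close>

lemma frob_sq_minus_leading_projection_le:
  assumes P: "leading_projection r A P" and A: "A \<in> carrier_mat m k" and B: "B \<in> carrier_mat m k"
    and rank: "vec_space.rank m B \<le> r"
  shows "frob_sq (A - P * A) \<le> real m * frob_sq (A - B)"
proof -
  obtain U S V where svd: "is_svd A U S V" and P: "P = U * cutoff_mat m r * transpose_mat U"
    using leading_projectionE[OF P A] .
  note U = is_svdD[OF svd A]
  have D: "cutoff_mat m r * S \<in> carrier_mat m k" by (rule mult_carrier_mat[OF cutoff_mat_carrier U(2)])
  have "transpose_mat U * A = S * transpose_mat V"
  proof -
    have "transpose_mat U * A = transpose_mat U * (U * (S * transpose_mat V))"
      using U by simp
    also have "\<dots> = (transpose_mat U * U) * (S * transpose_mat V)"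
      using U(1-3) by (subst assoc_mult_mat[of _ m m _ m _ k]) auto
    finally show ?thesis using U by simp
  qed
  then have "P * A = U * (cutoff_mat m r * (S * transpose_mat V))"
    using U(1-3) A by (simp add: P assoc_mult_mat[of _ m m _ m A k] assoc_mult_mat[of U m m _ m "S * transpose_mat V" k])
  also have "\<dots> = U * (cutoff_mat m r * S) * transpose_mat V"
    using U(1-3) D by (simp add: assoc_mult_mat[of _ m m _ k _ k])
  finally have "A - P * A = U * S * transpose_mat V - U * (cutoff_mat m r * S) * transpose_mat V"
    using U(6) by simp
  also have "\<dots> = U * (S - cutoff_mat m r * S) * transpose_mat V"
    using U(1-3) D by (simp add: minus_mult_distrib_mat[of _ m k _ _ k] mult_minus_distrib_mat[of _ m m _ k])
  finally have "frob_sq (A - P * A) = frob_sq (U * (S - cutoff_mat m r * S) * transpose_mat V)" by simp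
  also have "\<dots> = frob_sq (U * (S - cutoff_mat m r * S))"
    using orth_mult_transpose[OF U(3,5)] U(3)
    by (intro frob_sq_mult_orth_right[OF _ _ mult_carrier_mat[OF U(1) minus_carrier_mat[OF D]]]) simp_all
  also have "\<dots> = frob_sq (S - cutoff_mat m r * S)"
    by (rule frob_sq_mult_orth_left[OF U(1,4) minus_carrier_mat[OF D]])
  also have "\<dots> = (\<Sum>i<m. \<Sum>j<k. (if i < r then 0 else (S $$ (i, j))\<^sup>2))"
  proof -
    have "(S - cutoff_mat m r * S) $$ (i, j) = (if i < r then 0 else S $$ (i, j))"
      if "i < m" "j < k" for i j
      using that cutoff_mat_mult_index[OF U(2) that] carrier_matD[OF D]
      by (subst index_minus_mat) auto
    then show ?thesis
      unfolding frob_sq_carrier[OF minus_carrier_mat[OF D]] by (intro sum.cong refl) auto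
  qed
  also have "\<dots> \<le> (\<Sum>i<m. frob_sq (A - B))"
  proof (rule sum_mono)
    fix i assume i: "i \<in> {..<m}"
    have "(\<Sum>j<k. (if i < r then 0 else (S $$ (i, j))\<^sup>2)) =
        (\<Sum>j<k. if i = j then (if i < r then 0 else (S $$ (i, j))\<^sup>2) else 0)"
      using i U(7) by (intro sum.cong) auto
    also have "\<dots> = (if i < k \<and> r \<le> i then (S $$ (i, i))\<^sup>2 else 0)" by auto
    also have "\<dots> \<le> frob_sq (A - B)"
    proof (cases "i < k \<and> r \<le> i")
      case True
      then have "(S $$ (i, i))\<^sup>2 \<le> (S $$ (r, r))\<^sup>2"
        using U(8)[of i] U(9)[of r i] i by (intro power_mono) auto
      also have "\<dots> \<le> frob_sq (A - B)"
        using True i by (intro singular_value_le_frob_dist[OF svd A B rank]) auto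
      finally show ?thesis using True by simp
    qed (auto simp: frob_sq_nonneg)
    finally show "(\<Sum>j<k. (if i < r then 0 else (S $$ (i, j))\<^sup>2)) \<le> frob_sq (A - B)" .
  qed
  finally show ?thesis by simp
qed

section \<open>Multi-indices and matricizations\<close>

lemma linear_index_cong:
  "(\<And>m. m \<in> \<alpha> \<Longrightarrow> i m = j m) \<Longrightarrow> linear_index n \<alpha> i = linear_index n \<alpha> j"
  by (simp add: linear_index_def)

text \<open>
  The largest mode is the most significant digit of the mixed-radix number; the induction over the modes
  therefore adds them in increasing order.
\<close>

lemma linear_index_insert_max:
  assumes "finite \<alpha>" "\<forall>a\<in>\<alpha>. a < b"
  shows "linear_index n (insert b \<alpha>) i = linear_index n \<alpha> i + i b * (\<Prod>m\<in>\<alpha>. n m)"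
proof -
  have "b \<notin> \<alpha>" using assms by auto
  moreover have "{l \<in> insert b \<alpha>. l < b} = \<alpha>" using assms by auto
  moreover have "{l \<in> insert b \<alpha>. l < m} = {l \<in> \<alpha>. l < m}" if "m \<in> \<alpha>" for m
    using assms that by auto
  ultimately show ?thesis using assms(1) by (simp add: linear_index_def)
qed

lemma linear_index_less:
  assumes "finite \<alpha>" "\<And>m. m \<in> \<alpha> \<Longrightarrow> i m < n m"
  shows "linear_index n \<alpha> i < (\<Prod>m\<in>\<alpha>. n m)"
  using assms
proof (induction \<alpha> rule: finite_linorder_max_induct)
  case empty
  then show ?case by (simp add: linear_index_def)
next
  case (insert b \<alpha>)
  let ?p = "\<Prod>m\<in>\<alpha>. n m"
  have "linear_index n (insert b \<alpha>) i < ?p + i b * ?p"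
    using insert by (simp add: linear_index_insert_max)
  also have "\<dots> = Suc (i b) * ?p" by simp
  also have "\<dots> \<le> n b * ?p" using insert.prems[of b] by (intro mult_right_mono) auto
  also have "\<dots> = (\<Prod>m\<in>insert b \<alpha>. n m)" using insert.hyps by (subst prod.insert) auto
  finally show ?case .
qed

lemma linear_index_inj:
  assumes "finite \<alpha>" "\<And>m. m \<in> \<alpha> \<Longrightarrow> i m < n m" "\<And>m. m \<in> \<alpha> \<Longrightarrow> j m < n m"
    "linear_index n \<alpha> i = linear_index n \<alpha> j" "m \<in> \<alpha>"
  shows "i m = j m"
  using assms
proof (induction \<alpha> arbitrary: m rule: finite_linorder_max_induct)
  case (insert b \<alpha>)
  let ?p = "\<Prod>m\<in>\<alpha>. n m"
  have eq: "linear_index n \<alpha> i + i b * ?p = linear_index n \<alpha> j + j b * ?p"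
    using insert by (simp add: linear_index_insert_max)
  have less: "linear_index n \<alpha> i < ?p" "linear_index n \<alpha> j < ?p"
    using insert by (auto intro!: linear_index_less)
  have "i b = (linear_index n \<alpha> i + i b * ?p) div ?p" using less by simp
  also have "\<dots> = j b" using less by (simp add: eq)
  finally have b: "i b = j b" .
  show ?case
  proof (cases "m = b")
    case False
    then show ?thesis using insert eq b by auto
  qed (use b in simp)
qed simp

lemma bij_betw_linear_index:
  assumes "finite \<alpha>"
  shows "bij_betw (linear_index n \<alpha>) (\<Pi>\<^sub>E m\<in>\<alpha>. {..<n m}) {..<\<Prod>m\<in>\<alpha>. n m}"
proof -
  have inj: "inj_on (linear_index n \<alpha>) (\<Pi>\<^sub>E m\<in>\<alpha>. {..<n m})"
  proof (rule inj_onI)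
    fix x y assume xy: "x \<in> (\<Pi>\<^sub>E m\<in>\<alpha>. {..<n m})" "y \<in> (\<Pi>\<^sub>E m\<in>\<alpha>. {..<n m})"
      "linear_index n \<alpha> x = linear_index n \<alpha> y"
    show "x = y"
    proof (rule PiE_ext[OF xy(1,2)])
      fix m assume "m \<in> \<alpha>"
      then show "x m = y m" using xy by (intro linear_index_inj[OF assms _ _ xy(3)]) auto
    qed
  qed
  moreover have "linear_index n \<alpha> ` (\<Pi>\<^sub>E m\<in>\<alpha>. {..<n m}) = {..<\<Prod>m\<in>\<alpha>. n m}"
    using assms
    by (intro card_subset_eq) (auto simp: card_image[OF inj] card_PiE PiE_iff intro!: linear_index_less)
  ultimately show ?thesis by (simp add: bij_betw_def)
qed

context
  fixes d :: nat and n :: "nat \<Rightarrow> nat" and idx :: "'i::finite \<Rightarrow> nat \<Rightarrow> nat"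
  assumes tensor_index: "tensor_index d n idx"
begin

(* Keeps the set of modes in the form {1..d}. *)
declare One_nat_def [simp del]

lemma idx_less: "m \<in> {1..d} \<Longrightarrow> idx i m < n m"
  using tensor_index bij_betwE by (fastforce simp: tensor_index_def PiE_iff)

lemma idx_inj: "idx i = idx j \<Longrightarrow> i = j"
  using tensor_index by (auto simp: tensor_index_def bij_betw_def inj_on_def)

lemma idx_inv: "x \<in> (\<Pi>\<^sub>E m\<in>{1..d}. {..<n m}) \<Longrightarrow> idx (inv_into UNIV idx x) = x"
  using tensor_index by (simp add: tensor_index_def bij_betw_def f_inv_into_f)

lemma bij_betw_row_col:
  assumes "\<alpha> \<subseteq> {1..d}"
  shows "bij_betw (\<lambda>i. (linear_index n \<alpha> (idx i), linear_index n ({1..d} - \<alpha>) (idx i)))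
           UNIV ({..<\<Prod>m\<in>\<alpha>. n m} \<times> {..<\<Prod>m\<in>{1..d} - \<alpha>. n m})" (is "bij_betw ?f _ _")
proof -
  have fin: "finite \<alpha>" "finite ({1..d} - \<alpha>)" using assms finite_subset by auto
  have "inj ?f"
  proof (rule injI)
    fix i j assume eq: "?f i = ?f j"
    have "idx i m = idx j m" if "m \<in> {1..d}" for m
    proof (cases "m \<in> \<alpha>")
      case True
      then show ?thesis
        using linear_index_inj[OF fin(1), of "idx i" n "idx j" m] eq assms idx_less by (simp add: subset_iff)
    next
      case False
      then show ?thesis
        using linear_index_inj[OF fin(2), of "idx i" n "idx j" m] eq that idx_less by auto
    qed
    moreover have "idx i \<in> (\<Pi>\<^sub>E m\<in>{1..d}. {..<n m})" "idx j \<in> (\<Pi>\<^sub>E m\<in>{1..d}. {..<n m})"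
      using tensor_index bij_betwE unfolding tensor_index_def by blast+
    ultimately have "idx i = idx j" by (metis PiE_ext)
    then show "i = j" by (rule idx_inj)
  qed
  moreover have "range ?f = {..<\<Prod>m\<in>\<alpha>. n m} \<times> {..<\<Prod>m\<in>{1..d} - \<alpha>. n m}"
  proof (rule card_subset_eq)
    show "range ?f \<subseteq> {..<\<Prod>m\<in>\<alpha>. n m} \<times> {..<\<Prod>m\<in>{1..d} - \<alpha>. n m}"
      using fin assms by (auto intro!: linear_index_less idx_less)
    have "card (range ?f) = CARD('i)" using \<open>inj ?f\<close> by (rule card_image)
    also have "\<dots> = card (\<Pi>\<^sub>E m\<in>{1..d}. {..<n m})"
      using tensor_index unfolding tensor_index_def by (rule bij_betw_same_card)
    also have "\<dots> = (\<Prod>m\<in>{1..d}. n m)" by (simp add: card_PiE)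
    also have "\<dots> = (\<Prod>m\<in>{1..d} - \<alpha>. n m) * (\<Prod>m\<in>\<alpha>. n m)"
      using assms by (intro prod.subset_diff) auto
    finally show "card (range ?f) = card ({..<\<Prod>m\<in>\<alpha>. n m} \<times> {..<\<Prod>m\<in>{1..d} - \<alpha>. n m})"
      by (simp add: card_cartesian_product)
  qed simp
  ultimately show ?thesis by (simp add: bij_betw_def)
qed

lemma row_col_less:
  assumes "\<alpha> \<subseteq> {1..d}"
  shows "linear_index n \<alpha> (idx i) < (\<Prod>m\<in>\<alpha>. n m)"
    "linear_index n ({1..d} - \<alpha>) (idx i) < (\<Prod>m\<in>{1..d} - \<alpha>. n m)"
  using bij_betwE[OF bij_betw_row_col[OF assms]] by auto

lemma row_col_exhaust:
  assumes "\<alpha> \<subseteq> {1..d}" "a < (\<Prod>m\<in>\<alpha>. n m)" "b < (\<Prod>m\<in>{1..d} - \<alpha>. n m)"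
  obtains i where "a = linear_index n \<alpha> (idx i)" "b = linear_index n ({1..d} - \<alpha>) (idx i)"
proof -
  have "(a, b) \<in> range (\<lambda>i. (linear_index n \<alpha> (idx i), linear_index n ({1..d} - \<alpha>) (idx i)))"
    using assms(2,3) bij_betw_imp_surj_on[OF bij_betw_row_col[OF assms(1)]] by auto
  with that show thesis by auto
qed

lemma rows_le_card:
  assumes "\<alpha> \<subseteq> {1..d}"
  shows "(\<Prod>m\<in>\<alpha>. n m) \<le> CARD('i)"
proof -
  have "CARD('i) = (\<Prod>m\<in>\<alpha>. n m) * (\<Prod>m\<in>{1..d} - \<alpha>. n m)"
    using bij_betw_same_card[OF bij_betw_row_col[OF assms]] by (simp add: card_cartesian_product)
  moreover have "0 < CARD('i)" by simp
  ultimately show ?thesis by (metis One_nat_def Suc_leI mult.right_neutral mult_le_mono2 nat_0_less_mult_iff)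
qed

lemma matricize_carrier [simp]:
  "matricize d n idx \<alpha> f \<in> carrier_mat (\<Prod>m\<in>\<alpha>. n m) (\<Prod>m\<in>{1..d} - \<alpha>. n m)"
  by (simp add: matricize_def)

lemma matricize_index:
  assumes "\<alpha> \<subseteq> {1..d}"
  shows "matricize d n idx \<alpha> f $$ (linear_index n \<alpha> (idx i), linear_index n ({1..d} - \<alpha>) (idx i)) = f $ i"
proof -
  have "(THE j. linear_index n \<alpha> (idx j) = linear_index n \<alpha> (idx i) \<and>
      linear_index n ({1..d} - \<alpha>) (idx j) = linear_index n ({1..d} - \<alpha>) (idx i)) = i"
    using bij_betw_imp_inj_on[OF bij_betw_row_col[OF assms]] by (auto simp: inj_def)
  then show ?thesis using row_col_less[OF assms] by (simp add: matricize_def)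
qed

lemma tensorize_matricize:
  "\<alpha> \<subseteq> {1..d} \<Longrightarrow> tensorize d n idx \<alpha> (matricize d n idx \<alpha> f) = f"
  by (simp add: tensorize_def matricize_index Finite_Cartesian_Product.vec_eq_iff)

lemma matricize_diff:
  assumes "\<alpha> \<subseteq> {1..d}"
  shows "matricize d n idx \<alpha> (f - g) = matricize d n idx \<alpha> f - matricize d n idx \<alpha> g"
  by (rule eq_matI) (simp_all add: matricize_def)

lemma tensorize_diff:
  assumes "\<alpha> \<subseteq> {1..d}"
    and "B \<in> carrier_mat (\<Prod>m\<in>\<alpha>. n m) (\<Prod>m\<in>{1..d} - \<alpha>. n m)"
  shows "tensorize d n idx \<alpha> (A - B) = tensorize d n idx \<alpha> A - tensorize d n idx \<alpha> B"
  using assms(2) row_col_less[OF assms(1)] by (simp add: tensorize_def Finite_Cartesian_Product.vec_eq_iff)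

lemma norm_tensorize:
  fixes f :: "real ^ 'i"
  assumes "\<alpha> \<subseteq> {1..d}"
    and A: "A \<in> carrier_mat (\<Prod>m\<in>\<alpha>. n m) (\<Prod>m\<in>{1..d} - \<alpha>. n m)"
  shows "(norm (tensorize d n idx \<alpha> A :: real ^ 'i))\<^sup>2 = frob_sq A"
proof -
  have "(norm (tensorize d n idx \<alpha> A :: real ^ 'i))\<^sup>2 =
      (\<Sum>i\<in>UNIV. (A $$ (linear_index n \<alpha> (idx i), linear_index n ({1..d} - \<alpha>) (idx i)))\<^sup>2)"
    by (simp add: norm_vec_def L2_set_def tensorize_def sum_nonneg)
  also have "\<dots> = (\<Sum>c\<in>{..<\<Prod>m\<in>\<alpha>. n m} \<times> {..<\<Prod>m\<in>{1..d} - \<alpha>. n m}. (A $$ c)\<^sup>2)"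
    by (rule sum.reindex_bij_betw[OF bij_betw_row_col[OF assms(1)]])
  also have "\<dots> = frob_sq A" unfolding frob_sq_carrier[OF A] by (simp add: sum.cartesian_product)
  finally show ?thesis .
qed

lemma norm_eq_frob_sq_matricize:
  "\<alpha> \<subseteq> {1..d} \<Longrightarrow> (norm f)\<^sup>2 = frob_sq (matricize d n idx \<alpha> f)" for f :: "real ^ 'i"
  using norm_tensorize[of \<alpha> "matricize d n idx \<alpha> f"] by (simp add: tensorize_matricize)

section \<open>Projections acting on the modes of a node\<close>

lemma mode_mult_diff:
  assumes "\<alpha> \<subseteq> {1..d}" and P: "P \<in> carrier_mat (\<Prod>m\<in>\<alpha>. n m) (\<Prod>m\<in>\<alpha>. n m)"
  shows "mode_mult d n idx \<alpha> P (f - g) = mode_mult d n idx \<alpha> P f - mode_mult d n idx \<alpha> P g"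
  unfolding mode_mult_def matricize_diff[OF assms(1)]
  by (simp add: mult_minus_distrib_mat[OF P matricize_carrier matricize_carrier]
      tensorize_diff[OF assms(1) mult_carrier_mat[OF P matricize_carrier]])

lemma norm_mode_mult_le:
  assumes "\<alpha> \<subseteq> {1..d}" "leading_projection s (matricize d n idx \<alpha> a) P"
  shows "norm (mode_mult d n idx \<alpha> P f) \<le> norm f"
proof -
  have P: "P \<in> carrier_mat (\<Prod>m\<in>\<alpha>. n m) (\<Prod>m\<in>\<alpha>. n m)"
    using leading_projection_carrier[OF assms(2) matricize_carrier] .
  have "(norm (mode_mult d n idx \<alpha> P f))\<^sup>2 = frob_sq (P * matricize d n idx \<alpha> f)"
    unfolding mode_mult_def by (rule norm_tensorize[OF assms(1) mult_carrier_mat[OF P matricize_carrier]])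
  also have "\<dots> \<le> (norm f)\<^sup>2"
    unfolding norm_eq_frob_sq_matricize[OF assms(1)]
    by (rule frob_sq_leading_projection_le[OF assms(2) matricize_carrier matricize_carrier])
  finally show ?thesis by (simp add: power2_le_iff_abs_le)
qed

lemma norm_minus_mode_mult_le:
  fixes f :: "real ^ 'i"
  assumes "\<alpha> \<subseteq> {1..d}" "leading_projection s (matricize d n idx \<alpha> f) P"
    and rank: "vec_space.rank (\<Prod>m\<in>\<alpha>. n m) (matricize d n idx \<alpha> g) \<le> s"
  shows "norm (f - mode_mult d n idx \<alpha> P f) \<le> sqrt (CARD('i)) * norm (f - g)"
proof -
  let ?M = "matricize d n idx \<alpha>"
  have P: "P \<in> carrier_mat (\<Prod>m\<in>\<alpha>. n m) (\<Prod>m\<in>\<alpha>. n m)"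
    using leading_projection_carrier[OF assms(2) matricize_carrier] .
  note PM = mult_carrier_mat[OF P matricize_carrier]
  have "f - mode_mult d n idx \<alpha> P f = tensorize d n idx \<alpha> (?M f - P * ?M f)"
    unfolding mode_mult_def tensorize_diff[OF assms(1) PM] by (simp add: tensorize_matricize[OF assms(1)])
  then have "(norm (f - mode_mult d n idx \<alpha> P f))\<^sup>2 = frob_sq (?M f - P * ?M f)"
    using norm_tensorize[OF assms(1) minus_carrier_mat[OF PM]] by simp
  also have "\<dots> \<le> real (\<Prod>m\<in>\<alpha>. n m) * frob_sq (?M f - ?M g)"
    by (rule frob_sq_minus_leading_projection_le[OF assms(2) matricize_carrier matricize_carrier rank])
  also have "\<dots> \<le> real CARD('i) * frob_sq (?M f - ?M g)"
    using rows_le_card[OF assms(1)] by (intro mult_right_mono frob_sq_nonneg) (simp only: of_nat_le_iff)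
  also have "frob_sq (?M f - ?M g) = (norm (f - g))\<^sup>2"
    unfolding norm_eq_frob_sq_matricize[OF assms(1)] matricize_diff[OF assms(1)] ..
  also have "real CARD('i) * (norm (f - g))\<^sup>2 = (sqrt (CARD('i)) * norm (f - g))\<^sup>2"
    by (simp add: power_mult_distrib)
  finally show ?thesis by (rule power2_le_imp_le) simp
qed

text \<open>
  The rank of the matricization at \<open>\<alpha>\<close> is at most \<open>s\<close>, expressed by a factorization of the entries. Unlike
  a factorization of the matrix it treats the modes inside and outside \<open>\<alpha>\<close> alike, and it
  does not mention the linear order of rows and columns.
\<close>

definition separable :: "nat set \<Rightarrow> nat \<Rightarrow> real ^ 'i \<Rightarrow> bool" where
  "separable \<alpha> s f \<longleftrightarrow> (\<exists>g h. \<forall>i. f $ i =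
     (\<Sum>l<s. g l (restrict (idx i) \<alpha>) * h l (restrict (idx i) ({1..d} - \<alpha>))))"

lemma separable_complement:
  assumes "\<alpha> \<subseteq> {1..d}" "separable \<alpha> s f"
  shows "separable ({1..d} - \<alpha>) s f"
proof -
  have "{1..d} - ({1..d} - \<alpha>) = \<alpha>" using assms(1) by auto
  with assms(2) show ?thesis unfolding separable_def by (metis (no_types, lifting) mult.commute sum.cong)
qed

lemma rank_matricize_le:
  assumes \<alpha>: "\<alpha> \<subseteq> {1..d}" and "separable \<alpha> s f"
  shows "vec_space.rank (\<Prod>m\<in>\<alpha>. n m) (matricize d n idx \<alpha> f) \<le> s"
proof -
  obtain g h where gh: "\<And>i. f $ i =
      (\<Sum>l<s. g l (restrict (idx i) \<alpha>) * h l (restrict (idx i) ({1..d} - \<alpha>)))"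
    using assms(2) by (auto simp: separable_def)
  let ?dec = "\<lambda>\<beta>. inv_into (\<Pi>\<^sub>E m\<in>\<beta>. {..<n m}) (linear_index n \<beta>)"
  have dec: "?dec \<beta> (linear_index n \<beta> (idx i)) = restrict (idx i) \<beta>" if "\<beta> \<subseteq> {1..d}" for \<beta> i
  proof -
    have "linear_index n \<beta> (idx i) = linear_index n \<beta> (restrict (idx i) \<beta>)"
      by (rule linear_index_cong) simp
    moreover have "restrict (idx i) \<beta> \<in> (\<Pi>\<^sub>E m\<in>\<beta>. {..<n m})" using that idx_less by auto
    moreover have "finite \<beta>" using that finite_subset by auto
    ultimately show ?thesis
      using bij_betw_imp_inj_on[OF bij_betw_linear_index] by (metis inv_into_f_f)
  qed
  define G where "G = Matrix.mat (\<Prod>m\<in>\<alpha>. n m) s (\<lambda>(a, l). g l (?dec \<alpha> a))"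
  define H where "H = Matrix.mat s (\<Prod>m\<in>{1..d} - \<alpha>. n m) (\<lambda>(l, b). h l (?dec ({1..d} - \<alpha>) b))"
  have GH: "G \<in> carrier_mat (\<Prod>m\<in>\<alpha>. n m) s" "H \<in> carrier_mat s (\<Prod>m\<in>{1..d} - \<alpha>. n m)"
    by (simp_all add: G_def H_def)
  have "matricize d n idx \<alpha> f = G * H"
  proof (rule eq_matI)
    fix a b assume "a < dim_row (G * H)" "b < dim_col (G * H)"
    then have ab: "a < (\<Prod>m\<in>\<alpha>. n m)" "b < (\<Prod>m\<in>{1..d} - \<alpha>. n m)" using GH by auto
    then obtain i where i: "a = linear_index n \<alpha> (idx i)" "b = linear_index n ({1..d} - \<alpha>) (idx i)"
      using row_col_exhaust[OF \<alpha>] by metis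
    have "?dec \<alpha> a = restrict (idx i) \<alpha>"
      "?dec ({1..d} - \<alpha>) b = restrict (idx i) ({1..d} - \<alpha>)"
      unfolding i using dec[OF \<alpha>] dec[of "{1..d} - \<alpha>"] by auto
    then have "(G * H) $$ (a, b) = f $ i"
      unfolding mult_index_sum[OF GH ab] gh by (intro sum.cong) (use ab in \<open>auto simp: G_def H_def\<close>)
    then show "matricize d n idx \<alpha> f $$ (a, b) = (G * H) $$ (a, b)"
      unfolding i by (simp only: matricize_index[OF \<alpha>])
  qed (use GH in \<open>auto simp: matricize_def\<close>)
  then show ?thesis using rank_mult_le_inner[OF GH] by simp
qed

text \<open>
  With \<open>W\<close> the matrix of singular vectors, \<open>W\<close> and \<open>transpose_mat W * matricize d n idx \<alpha> f\<close> are the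
  two factors; if \<open>W\<close> has fewer than \<open>s\<close> columns, the missing terms are zero.
\<close>

lemma separable_mode_mult_leading_projection:
  assumes \<alpha>: "\<alpha> \<subseteq> {1..d}" and "leading_projection s (matricize d n idx \<alpha> a) P"
  shows "separable \<alpha> s (mode_mult d n idx \<alpha> P f)"
proof -
  let ?m = "\<Prod>m\<in>\<alpha>. n m"
  obtain U S V where svd: "is_svd (matricize d n idx \<alpha> a) U S V" and
    P: "P = Matrix.mat (dim_row U) (min s (dim_col U)) (\<lambda>(i, j). U $$ (i, j)) *
          transpose_mat (Matrix.mat (dim_row U) (min s (dim_col U)) (\<lambda>(i, j). U $$ (i, j)))"
      (is "_ = ?W * _")
    using assms(2) unfolding leading_projection_def Let_def by blast
  let ?t = "min s ?m"
  have W: "?W \<in> carrier_mat ?m ?t" using is_svdD(1)[OF svd matricize_carrier] by auto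
  define H where "H = transpose_mat ?W * matricize d n idx \<alpha> f"
  have WT: "transpose_mat ?W \<in> carrier_mat ?t ?m" using W by (simp only: transpose_carrier_mat)
  have H: "H \<in> carrier_mat ?t (\<Prod>m\<in>{1..d} - \<alpha>. n m)"
    unfolding H_def by (rule mult_carrier_mat[OF WT matricize_carrier])
  have PH: "P * matricize d n idx \<alpha> f = ?W * H"
    unfolding P H_def by (rule assoc_mult_mat[OF W WT matricize_carrier])
  have lin: "linear_index n \<beta> (restrict (idx i) \<beta>) = linear_index n \<beta> (idx i)" for \<beta> i
    by (rule linear_index_cong) simp
  define g where "g l x = (if l < ?t then ?W $$ (linear_index n \<alpha> x, l) else 0)" for l x
  define h where "h l x = H $$ (l, linear_index n ({1..d} - \<alpha>) x)" for l x
  have "mode_mult d n idx \<alpha> P f $ i =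
      (\<Sum>l<s. g l (restrict (idx i) \<alpha>) * h l (restrict (idx i) ({1..d} - \<alpha>)))" for i
  proof -
    have "mode_mult d n idx \<alpha> P f $ i = (\<Sum>l<?t. ?W $$ (linear_index n \<alpha> (idx i), l) *
        H $$ (l, linear_index n ({1..d} - \<alpha>) (idx i)))"
      unfolding mode_mult_def tensorize_def PH
      by (simp only: vec_lambda_beta mult_index_sum[OF W H row_col_less[OF \<alpha>]])
    also have "\<dots> = (\<Sum>l<s. g l (restrict (idx i) \<alpha>) * h l (restrict (idx i) ({1..d} - \<alpha>)))"
      unfolding g_def h_def lin by (intro sum.mono_neutral_cong_left) auto
    finally show ?thesis .
  qed
  then show ?thesis unfolding separable_def by blast
qed

text \<open>
  The entrywise form shows what happens at another node \<open>\<alpha>\<close>: only the coordinates in \<open>\<beta>\<close> are summed over,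
  and those outside \<open>\<beta>\<close> are left as they are.
\<close>

lemma mode_mult_index:
  assumes \<beta>: "\<beta> \<subseteq> {1..d}" and P: "P \<in> carrier_mat (\<Prod>m\<in>\<beta>. n m) (\<Prod>m\<in>\<beta>. n m)"
  shows "mode_mult d n idx \<beta> P f $ i = (\<Sum>y\<in>(\<Pi>\<^sub>E m\<in>\<beta>. {..<n m}).
    P $$ (linear_index n \<beta> (idx i), linear_index n \<beta> y) * f $ inv_into UNIV idx (override_on (idx i) y \<beta>))"
proof -
  let ?M = "matricize d n idx \<beta> f" and ?c = "linear_index n ({1..d} - \<beta>) (idx i)"
  have "mode_mult d n idx \<beta> P f $ i =
      (\<Sum>b<\<Prod>m\<in>\<beta>. n m. P $$ (linear_index n \<beta> (idx i), b) * ?M $$ (b, ?c))"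
    unfolding mode_mult_def tensorize_def
    by (simp only: vec_lambda_beta mult_index_sum[OF P matricize_carrier row_col_less[OF \<beta>]])
  also have "\<dots> = (\<Sum>y\<in>(\<Pi>\<^sub>E m\<in>\<beta>. {..<n m}).
      P $$ (linear_index n \<beta> (idx i), linear_index n \<beta> y) * ?M $$ (linear_index n \<beta> y, ?c))"
    using \<beta> finite_subset by (intro sum.reindex_bij_betw[symmetric] bij_betw_linear_index) auto
  also have "\<dots> = (\<Sum>y\<in>(\<Pi>\<^sub>E m\<in>\<beta>. {..<n m}).
      P $$ (linear_index n \<beta> (idx i), linear_index n \<beta> y) * f $ inv_into UNIV idx (override_on (idx i) y \<beta>))"
  proof (intro sum.cong refl arg_cong2[where f = "(*)"])
    fix y assume y: "y \<in> (\<Pi>\<^sub>E m\<in>\<beta>. {..<n m})"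
    let ?z = "override_on (idx i) y \<beta>"
    have "idx i \<in> (\<Pi>\<^sub>E m\<in>{1..d}. {..<n m})"
      using tensor_index bij_betwE unfolding tensor_index_def by blast
    then have "?z \<in> (\<Pi>\<^sub>E m\<in>{1..d}. {..<n m})"
      using y \<beta> by (auto simp: PiE_iff override_on_def extensional_def)
    then have z: "idx (inv_into UNIV idx ?z) = ?z" by (rule idx_inv)
    have "linear_index n \<beta> ?z = linear_index n \<beta> y" "linear_index n ({1..d} - \<beta>) ?z = ?c"
      by (auto intro!: linear_index_cong)
    then show "?M $$ (linear_index n \<beta> y, ?c) = f $ inv_into UNIV idx ?z"
      using matricize_index[OF \<beta>, of f "inv_into UNIV idx ?z"] unfolding z by simp
  qed
  finally show ?thesis .
qed

text \<open>
  All coordinates that change lie in \<open>\<alpha>\<close>, so the sum over them is absorbed by the first factor.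
\<close>

lemma separable_mode_mult_subset:
  assumes "\<beta> \<subseteq> \<alpha>" "\<alpha> \<subseteq> {1..d}" and P: "P \<in> carrier_mat (\<Prod>m\<in>\<beta>. n m) (\<Prod>m\<in>\<beta>. n m)"
    and "separable \<alpha> s f"
  shows "separable \<alpha> s (mode_mult d n idx \<beta> P f)"
proof -
  obtain g h where gh: "\<And>i. f $ i =
      (\<Sum>l<s. g l (restrict (idx i) \<alpha>) * h l (restrict (idx i) ({1..d} - \<alpha>)))"
    using assms(4) by (auto simp: separable_def)
  define g' where "g' l x = (\<Sum>y\<in>(\<Pi>\<^sub>E m\<in>\<beta>. {..<n m}).
    P $$ (linear_index n \<beta> x, linear_index n \<beta> y) * g l (override_on x y \<beta>))" for l x
  have \<beta>: "\<beta> \<subseteq> {1..d}" using assms by auto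
  have "mode_mult d n idx \<beta> P f $ i =
      (\<Sum>l<s. g' l (restrict (idx i) \<alpha>) * h l (restrict (idx i) ({1..d} - \<alpha>)))" for i
  proof -
    have "f $ inv_into UNIV idx (override_on (idx i) y \<beta>) =
        (\<Sum>l<s. g l (override_on (restrict (idx i) \<alpha>) y \<beta>) * h l (restrict (idx i) ({1..d} - \<alpha>)))"
      if y: "y \<in> (\<Pi>\<^sub>E m\<in>\<beta>. {..<n m})" for y
    proof -
      have "idx i \<in> (\<Pi>\<^sub>E m\<in>{1..d}. {..<n m})"
        using tensor_index bij_betwE unfolding tensor_index_def by blast
      then have "override_on (idx i) y \<beta> \<in> (\<Pi>\<^sub>E m\<in>{1..d}. {..<n m})"
        using y \<beta> by (auto simp: PiE_iff override_on_def extensional_def)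
      then have z: "idx (inv_into UNIV idx (override_on (idx i) y \<beta>)) = override_on (idx i) y \<beta>" by (rule idx_inv)
      have "restrict (override_on (idx i) y \<beta>) \<alpha> = override_on (restrict (idx i) \<alpha>) y \<beta>"
        "restrict (override_on (idx i) y \<beta>) ({1..d} - \<alpha>) = restrict (idx i) ({1..d} - \<alpha>)"
        using assms(1) by (auto simp: override_on_def restrict_def fun_eq_iff)
      then show ?thesis unfolding gh z by simp
    qed
    moreover have "linear_index n \<beta> (restrict (idx i) \<alpha>) = linear_index n \<beta> (idx i)"
      using assms(1) by (intro linear_index_cong) auto
    ultimately show ?thesis
      unfolding mode_mult_index[OF \<beta> P] g'_def
      by (subst sum_distrib_right, subst sum.swap) (simp add: sum_distrib_left mult.assoc)
  qed
  then show ?thesis unfolding separable_def by blast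
qed

text \<open>
  If \<open>\<beta>\<close> is disjoint from \<open>\<alpha>\<close>, it is contained in the complement of \<open>\<alpha>\<close>, with the two factors exchanged.
\<close>

lemma separable_mode_mult:
  assumes "\<beta> \<subseteq> \<alpha> \<or> \<alpha> \<inter> \<beta> = {}" and \<alpha>: "\<alpha> \<subseteq> {1..d}" and \<beta>: "\<beta> \<subseteq> {1..d}"
    and P: "P \<in> carrier_mat (\<Prod>m\<in>\<beta>. n m) (\<Prod>m\<in>\<beta>. n m)" and "separable \<alpha> s f"
  shows "separable \<alpha> s (mode_mult d n idx \<beta> P f)"
  using assms(1)
proof
  assume "\<beta> \<subseteq> \<alpha>"
  then show ?thesis using separable_mode_mult_subset assms by blast
next
  assume "\<alpha> \<inter> \<beta> = {}"
  then have "\<beta> \<subseteq> {1..d} - \<alpha>" using \<beta> by auto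
  then have "separable ({1..d} - \<alpha>) s (mode_mult d n idx \<beta> P f)"
    using separable_mode_mult_subset[OF _ _ P] separable_complement[OF \<alpha> assms(5)] by blast
  from separable_complement[OF _ this] show ?thesis using \<alpha> by (simp add: double_diff)
qed

end

section \<open>Nodes of a dimension tree\<close>

lemma layer_subset_modes: "\<alpha> \<in> set (layer T j) \<Longrightarrow> \<alpha> \<subseteq> modes T"
  by (induction T arbitrary: j) (auto split: if_splits nat.splits)

text \<open>
  Two nodes are nested or disjoint; the order of the layers excludes that the later node strictly contains the
  earlier one.
\<close>

lemma later_layer_nested_or_disjoint:
  assumes "disjoint_children T" "\<alpha> \<in> set (layer T i)" "\<beta> \<in> set (layer T j)" "i \<le> j"
  shows "\<beta> \<subseteq> \<alpha> \<or> \<alpha> \<inter> \<beta> = {}"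
  using assms
proof (induction T arbitrary: i j)
  case (Branch s t)
  show ?case
  proof (cases i)
    case 0
    then have "\<alpha> = modes (Branch s t)" using Branch.prems(2) by simp
    then show ?thesis using layer_subset_modes[OF Branch.prems(3)] by simp
  next
    case (Suc i')
    then obtain j' where j': "j = Suc j'" "i' \<le> j'" using Branch.prems(4) by (cases j) auto
    have "\<alpha> \<in> set (layer s i') \<or> \<alpha> \<in> set (layer t i')"
      "\<beta> \<in> set (layer s j') \<or> \<beta> \<in> set (layer t j')"
      using Branch.prems(2,3) Suc j'(1) by auto
    moreover have "modes s \<inter> modes t = {}" using Branch.prems(1) by simp
    ultimately show ?thesis
      using Branch.IH(1)[of i' j'] Branch.IH(2)[of i' j'] Branch.prems(1) j'(2)
        layer_subset_modes[of \<alpha> s i'] layer_subset_modes[of \<alpha> t i']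
        layer_subset_modes[of \<beta> s j'] layer_subset_modes[of \<beta> t j']
      by auto blast+
  qed
qed (auto split: if_splits)

lemma sorted_wrt_layer:
  assumes "disjoint_children T"
  shows "sorted_wrt (\<lambda>\<alpha> \<beta>. \<beta> \<subseteq> \<alpha> \<or> \<alpha> \<inter> \<beta> = {}) (layer T j)"
  unfolding sorted_wrt_iff_nth_less
  by (intro allI impI later_layer_nested_or_disjoint[OF assms nth_mem nth_mem order_refl]) auto

lemma sorted_wrt_nodes_below_root:
  assumes "disjoint_children T"
  shows "sorted_wrt (\<lambda>\<alpha> \<beta>. \<beta> \<subseteq> \<alpha> \<or> \<alpha> \<inter> \<beta> = {}) (nodes_below_root T)"
proof -
  have "sorted_wrt (\<lambda>\<alpha> \<beta>. \<beta> \<subseteq> \<alpha> \<or> \<alpha> \<inter> \<beta> = {}) (concat (map (layer T) [1..<l]))" for l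
  proof (induction l)
    case (Suc l)
    then show ?case
      using sorted_wrt_layer[OF assms] later_layer_nested_or_disjoint[OF assms]
      by (auto simp: sorted_wrt_append less_imp_le)
  qed simp
  then show ?thesis unfolding nodes_below_root_def .
qed

lemma set_nodes_below_root: "set (nodes_below_root T) = (\<Union>j\<in>{1..depth T}. set (layer T j))"
  unfolding nodes_below_root_def by (simp del: upt_Suc add: atLeastLessThanSuc_atLeastAtMost)

lemma nodes_subset_layers: "\<alpha> \<in> nodes T \<Longrightarrow> \<exists>j\<le>depth T. \<alpha> \<in> set (layer T j)"
proof (induction T)
  case (Branch s t)
  from Branch.prems consider "\<alpha> = modes (Branch s t)" | "\<alpha> \<in> nodes s" | "\<alpha> \<in> nodes t" by auto
  then show ?case
  proof cases
    case 1
    then show ?thesis by (intro exI[of _ 0]) simp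
  next
    case 2
    then obtain j where "j \<le> depth s" "\<alpha> \<in> set (layer s j)" using Branch.IH(1) by blast
    then show ?thesis by (intro exI[of _ "Suc j"]) simp
  next
    case 3
    then obtain j where "j \<le> depth t" "\<alpha> \<in> set (layer t j)" using Branch.IH(2) by blast
    then show ?thesis by (intro exI[of _ "Suc j"]) simp
  qed
qed simp

lemma layer_subset_nodes: "\<alpha> \<in> set (layer T j) \<Longrightarrow> \<alpha> \<in> nodes T"
  by (induction T arbitrary: j) (auto split: if_splits nat.splits)

lemma node_below_root_or_root:
  assumes "\<alpha> \<in> nodes T"
  shows "\<alpha> = modes T \<or> \<alpha> \<in> set (nodes_below_root T)"
proof -
  obtain j where j: "j \<le> depth T" "\<alpha> \<in> set (layer T j)" using nodes_subset_layers[OF assms] by blast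
  show ?thesis
  proof (cases j)
    case 0
    then show ?thesis using j(2) by (cases T) auto
  next
    case (Suc j')
    then have "j \<in> {1..depth T}" using j(1) by simp
    then show ?thesis using j(2) unfolding set_nodes_below_root by blast
  qed
qed

lemma nodes_below_root_subset_nodes: "set (nodes_below_root T) \<subseteq> nodes T"
  by (auto simp: set_nodes_below_root layer_subset_nodes)

lemma nodes_subset_modes: "\<alpha> \<in> nodes T \<Longrightarrow> \<alpha> \<subseteq> modes T"
  using nodes_subset_layers layer_subset_modes by blast

section \<open>Near-best approximation by the SVD truncation\<close>

text \<open>
  The new error at \<open>f\<close> is added, and the error made so far is not enlarged by a map that does not increase
  distances. Every map is compared with the identity at the original \<open>f\<close>, which is the tensor from
  which all projections are computed.
\<close>

lemma norm_minus_fold_nonexpansive_le: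
  fixes f :: "'a::real_normed_vector"
  assumes "\<And>x u v. x \<in> set xs \<Longrightarrow> norm (Q x u - Q x v) \<le> norm (u - v)"
    and "\<And>x. x \<in> set xs \<Longrightarrow> norm (f - Q x f) \<le> e"
  shows "norm (f - fold Q xs f) \<le> real (length xs) * e"
  using assms
proof (induction xs rule: rev_induct)
  case (snoc x xs)
  have "f - fold Q (xs @ [x]) f = (f - Q x f) + (Q x f - Q x (fold Q xs f))" by simp
  also have "norm \<dots> \<le> norm (f - Q x f) + norm (Q x f - Q x (fold Q xs f))" by (rule norm_triangle_ineq)
  also have "\<dots> \<le> e + norm (f - fold Q xs f)" using snoc.prems by (intro add_mono) auto
  also have "\<dots> \<le> e + real (length xs) * e" using snoc by simp
  finally show ?case by (simp add: algebra_simps)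
qed simp

lemma norm_minus_svd_truncation_le:
  fixes f :: "real ^ 'i::finite"
  assumes idx: "tensor_index d n idx" and T: "dimension_tree d T"
    and svd: "is_svd_truncation d n idx T s f g" and h: "h \<in> ht_closure d n idx T s"
  shows "norm (f - g) \<le> real (length (nodes_below_root T)) * sqrt (CARD('i)) * norm (f - h)"
proof -
  obtain P where P: "\<And>\<alpha>. \<alpha> \<in> set (nodes_below_root T) \<Longrightarrow>
      leading_projection (s \<alpha>) (matricize d n idx \<alpha> f) (P \<alpha>)"
    and g: "g = fold (\<lambda>\<alpha>. mode_mult d n idx \<alpha> (P \<alpha>)) (nodes_below_root T) f"
    using svd by (auto simp: is_svd_truncation_def)
  have sub: "\<alpha> \<subseteq> {1..d}" if "\<alpha> \<in> set (nodes_below_root T)" for \<alpha>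
    using that T nodes_below_root_subset_nodes[of T] nodes_subset_modes[of \<alpha> T] by (auto simp: dimension_tree_def)
  have "norm (f - g) \<le> real (length (nodes_below_root T)) * (sqrt (CARD('i)) * norm (f - h))"
    unfolding g
  proof (rule norm_minus_fold_nonexpansive_le)
    fix \<alpha> u v assume \<alpha>: "\<alpha> \<in> set (nodes_below_root T)"
    show "norm (mode_mult d n idx \<alpha> (P \<alpha>) u - mode_mult d n idx \<alpha> (P \<alpha>) v) \<le> norm (u - v)"
      using norm_mode_mult_le[OF idx sub[OF \<alpha>] P[OF \<alpha>], of "u - v"]
        mode_mult_diff[OF idx sub[OF \<alpha>] leading_projection_carrier[OF P[OF \<alpha>] matricize_carrier[OF idx]]]
      by simp
  next
    fix \<alpha> assume \<alpha>: "\<alpha> \<in> set (nodes_below_root T)"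
    show "norm (f - mode_mult d n idx \<alpha> (P \<alpha>) f) \<le> sqrt (CARD('i)) * norm (f - h)"
      using h \<alpha> nodes_below_root_subset_nodes[of T]
      by (intro norm_minus_mode_mult_le[OF idx sub[OF \<alpha>] P[OF \<alpha>]]) (auto simp: ht_closure_def)
  qed
  then show ?thesis by (simp add: mult.assoc)
qed

lemma svd_truncation_in_ht_closure:
  assumes idx: "tensor_index d n idx" and T: "dimension_tree d T"
    and svd: "is_svd_truncation d n idx T s f g" and root: "1 \<le> s {1..d}"
  shows "g \<in> ht_closure d n idx T s"
  unfolding ht_closure_def
proof (intro CollectI ballI)
  let ?xs = "nodes_below_root T"
  obtain P where P: "\<And>\<alpha>. \<alpha> \<in> set ?xs \<Longrightarrow> leading_projection (s \<alpha>) (matricize d n idx \<alpha> f) (P \<alpha>)"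
    and g: "g = fold (\<lambda>\<alpha>. mode_mult d n idx \<alpha> (P \<alpha>)) ?xs f"
    using svd by (auto simp: is_svd_truncation_def)
  have sub: "\<alpha> \<subseteq> {1..d}" if "\<alpha> \<in> set ?xs" for \<alpha>
    using that T nodes_below_root_subset_nodes[of T] nodes_subset_modes[of \<alpha> T] by (auto simp: dimension_tree_def)
  fix \<alpha> assume "\<alpha> \<in> nodes T"
  then consider "\<alpha> = {1..d}" | "\<alpha> \<in> set ?xs"
    using node_below_root_or_root[of \<alpha> T] T by (auto simp: dimension_tree_def)
  then show "vec_space.rank (\<Prod>m\<in>\<alpha>. n m) (matricize d n idx \<alpha> g) \<le> s \<alpha>"
  proof cases
    case 1
    have "matricize d n idx \<alpha> g \<in> carrier_mat (\<Prod>m\<in>\<alpha>. n m) 1"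
      using matricize_carrier[OF idx, of \<alpha> g] 1 by simp
    from vec_space.rank_le_nc[OF this] root 1 show ?thesis by simp
  next
    case 2
    then obtain ys zs where xs: "?xs = ys @ \<alpha> # zs" by (meson split_list)
    have zs: "\<beta> \<subseteq> \<alpha> \<or> \<alpha> \<inter> \<beta> = {}" if "\<beta> \<in> set zs" for \<beta>
      using sorted_wrt_nodes_below_root[of T] T that
      by (auto simp: xs sorted_wrt_append dimension_tree_def)
    (* The projection at \<alpha> makes any tensor separable, so only the nodes after \<alpha> matter. *)
    have "separable d idx \<alpha> (s \<alpha>) (fold (\<lambda>\<alpha>. mode_mult d n idx \<alpha> (P \<alpha>)) bs
        (mode_mult d n idx \<alpha> (P \<alpha>) u))" if "set bs \<subseteq> set zs" for bs u
      using that
    proof (induction bs rule: rev_induct)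
      case Nil
      then show ?case
        using separable_mode_mult_leading_projection[OF idx sub[OF 2] P[OF 2]] by simp
    next
      case (snoc \<beta> bs)
      then have \<beta>: "\<beta> \<in> set zs" "\<beta> \<in> set ?xs" by (auto simp: xs)
      then show ?case
        using snoc separable_mode_mult[OF idx zs sub[OF 2] sub
            leading_projection_carrier[OF P matricize_carrier[OF idx]]] by simp
    qed
    from this[of zs] have "separable d idx \<alpha> (s \<alpha>) g" by (simp add: g xs)
    then show ?thesis by (rule rank_matricize_le[OF idx sub[OF 2]])
  qed
qed

section \<open>Local error and best approximation error\<close>

theorem corollary1:
  fixes d p :: nat
    and n :: "nat \<Rightarrow> nat"
    and idx :: "'i::finite \<Rightarrow> nat \<Rightarrow> nat"
    and T :: dim_tree
    and N :: "real ^ 'i \<Rightarrow> real ^ 'i"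
    and \<Phi> :: "(real ^ 'i \<Rightarrow> real ^ 'i) \<Rightarrow> real ^ 'i \<Rightarrow> real \<Rightarrow> real ^ 'i"
    and r :: "real \<Rightarrow> nat \<Rightarrow> nat set \<Rightarrow> nat"
    and Tbest Tsvd :: "(nat set \<Rightarrow> nat) \<Rightarrow> real ^ 'i \<Rightarrow> real ^ 'i"
    and f a :: "real \<Rightarrow> nat \<Rightarrow> real ^ 'i"
  assumes "d \<ge> 2"
    and "tensor_index d n idx"
    and "dimension_tree d T"
    and "\<And>s g. is_best_truncation d n idx T s g (Tbest s g)"
    and "\<And>s g. is_svd_truncation d n idx T s g (Tsvd s g)"
    and "\<And>h k. h > 0 \<Longrightarrow> r h k {1..d} \<ge> 1"
    and "\<And>h k. h > 0 \<Longrightarrow> a h k = f h k + h *\<^sub>R \<Phi> N (f h k) h"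
    and "\<And>h k. h > 0 \<Longrightarrow> f h (Suc k) = Tsvd (r h k) (a h k)"
    and "\<forall>\<^sub>F h in at_right 0. \<forall>k. \<exists>u. solves_ivp N (real k * h) (f h k) (real (Suc k) * h) u"
    and "increment_function_of_order p \<Phi> N f"
  shows "local_truncation_error_of_order p N f \<longleftrightarrow>
    (\<exists>M>0. \<forall>\<^sub>F h in at_right 0. \<forall>k. norm (a h k - Tbest (r h k) (a h k)) \<le> M * h ^ (p + 1))"
proof -
  let ?solves = "\<lambda>h k u. solves_ivp N (real k * h) (f h k) (real (Suc k) * h) u"
  let ?best = "\<lambda>h k. norm (a h k - Tbest (r h k) (a h k))"
  (* L is the factor between the errors of the SVD truncation and of the best truncation. *)
  define L where "L = real (length (nodes_below_root T)) * sqrt (CARD('i))"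
  have "L \<ge> 0" by (simp add: L_def)
  have pos: "\<forall>\<^sub>F h in at_right 0. (0::real) < h" by (rule eventually_at_right_less)
  have best_le: "?best h k \<le> norm (a h k - f h (Suc k))" if "h > 0" for h k
    using assms(4)[of "r h k" "a h k"] that assms(8)
      svd_truncation_in_ht_closure[OF assms(2,3) assms(5)[of "r h k" "a h k"] assms(6)[OF that]]
    by (auto simp: is_best_truncation_def is_arg_min_def not_less)
  have svd_le: "norm (a h k - f h (Suc k)) \<le> L * ?best h k" if "h > 0" for h k
    using assms(4)[of "r h k" "a h k"] unfolding assms(8)[OF that] L_def
    by (intro norm_minus_svd_truncation_le[OF assms(2,3,5)]) (auto simp: is_best_truncation_def is_arg_min_def)
  obtain K where K: "\<forall>\<^sub>F h in at_right 0. \<forall>k u. ?solves h k u \<longrightarrow>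
      norm (u (real (Suc k) * h) - (f h k + h *\<^sub>R \<Phi> N (f h k) h)) \<le> K * h ^ (p + 1)"
    using assms(10) by (auto simp: increment_function_of_order_def)
  show ?thesis
  proof
    assume "local_truncation_error_of_order p N f"
    then obtain C where C: "\<forall>\<^sub>F h in at_right 0. \<forall>k u. ?solves h k u \<longrightarrow>
        norm (u (real (Suc k) * h) - f h (Suc k)) \<le> C * h ^ (p + 1)"
      by (auto simp: local_truncation_error_of_order_def)
    (* K + C need not be positive, but M must be. *)
    have "\<forall>\<^sub>F h in at_right 0. \<forall>k. ?best h k \<le> (\<bar>K + C\<bar> + 1) * h ^ (p + 1)"
      using pos assms(9) K C
    proof eventually_elim
      case (elim h)
      show ?case
      proof
        fix k
        obtain u where u: "?solves h k u" using elim(2) by blast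
        let ?u = "u (real (Suc k) * h)"
        have "?best h k \<le> norm (a h k - f h (Suc k))" using best_le elim(1) .
        also have "\<dots> \<le> norm (?u - a h k) + norm (?u - f h (Suc k))"
          using norm_triangle_ineq4[of "?u - f h (Suc k)" "?u - a h k"] by simp
        also have "\<dots> \<le> K * h ^ (p + 1) + C * h ^ (p + 1)"
          using elim(3,4) u by (intro add_mono) (auto simp: assms(7)[OF elim(1)])
        also have "\<dots> = (K + C) * h ^ (p + 1)" by (simp add: algebra_simps)
        also have "\<dots> \<le> (\<bar>K + C\<bar> + 1) * h ^ (p + 1)"
          using elim(1) by (intro mult_right_mono) auto
        finally show "?best h k \<le> (\<bar>K + C\<bar> + 1) * h ^ (p + 1)" .
      qed
    qed
    then show "\<exists>M>0. \<forall>\<^sub>F h in at_right 0. \<forall>k. ?best h k \<le> M * h ^ (p + 1)"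
      by (intro exI[of _ "\<bar>K + C\<bar> + 1"]) auto
  next
    assume "\<exists>M>0. \<forall>\<^sub>F h in at_right 0. \<forall>k. ?best h k \<le> M * h ^ (p + 1)"
    then obtain M where M: "\<forall>\<^sub>F h in at_right 0. \<forall>k. ?best h k \<le> M * h ^ (p + 1)" by blast
    have "\<forall>\<^sub>F h in at_right 0. \<forall>k u. ?solves h k u \<longrightarrow>
        norm (u (real (Suc k) * h) - f h (Suc k)) \<le> (K + L * M) * h ^ (p + 1)"
      using pos K M
    proof eventually_elim
      case (elim h)
      show ?case
      proof (intro allI impI)
        fix k u assume u: "?solves h k u"
        let ?u = "u (real (Suc k) * h)"
        have "norm (?u - f h (Suc k)) \<le> norm (?u - a h k) + norm (a h k - f h (Suc k))"
          using norm_triangle_ineq[of "?u - a h k" "a h k - f h (Suc k)"] by simp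
        also have "\<dots> \<le> K * h ^ (p + 1) + L * ?best h k"
          using elim(2) u svd_le[OF elim(1)] by (intro add_mono) (auto simp: assms(7)[OF elim(1)])
        also have "\<dots> \<le> K * h ^ (p + 1) + L * (M * h ^ (p + 1))"
          using elim(3) \<open>L \<ge> 0\<close> by (intro add_left_mono mult_left_mono) auto
        finally show "norm (?u - f h (Suc k)) \<le> (K + L * M) * h ^ (p + 1)" by (simp add: algebra_simps)
      qed
    qed
    then show "local_truncation_error_of_order p N f"
      unfolding local_truncation_error_of_order_def by blast
  qed
qed

end
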